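(* Let $C$ be a category, let $F \colon C \to \mathsf{Ab}$ be a functor to the category of Abelian groups, let $X$ be an object of $C$, and let $\alpha \in F(X)$ be weakly flexible with respect to $F$. If $|\cdot|$ is a finite homogeneous functorial semi-norm on $F$, then $|\alpha| = 0$.
   Context: A finite semi-norm on an Abelian group $A$ is a map $|\cdot| \colon A \to \mathbb{R}_{\ge 0}$ with $|0|=0$, $|-x|=|x|$ and $|x+y|\le |x|+|y|$ for all $x,y\in A$. It is homogeneous if $|n\cdot x| = |n|\cdot|x|$ for all $n\in\mathbb{Z}\setminus\{0\}$ and all $x\in A$. A finite functorial semi-norm on a functor $F\colon C\to\mathsf{Ab}$ is a choice of a finite semi-norm $|\cdot|$ on $F(X)$ for every object $X$ of $C$ such that $|F(f)(\alpha)|\le|\alpha|$ for all morphisms $f\colon X\to Y$ in $C$ and all $\alpha\in F(X)$. It is homogeneous if all these semi-norms are homogeneous. An element $\alpha\in F(X)$ is weakly flexible with respect to $F$ if there exist an object $Y$ of $C$ and $\beta\in F(Y)$ such that the set $D(\beta,\alpha)=\{d\in\mathbb{Z} \mid \exists f\in \mathrm{Mor}_C(Y,X):\ F(f)(\beta)=d\cdot\alpha\}$ is infinite. *)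

theory Defs
  imports Complex_Main "HOL-Algebra.Group"
begin

record ('o, 'm) cat =
  Ob :: "'o set"
  Mor :: "'m set"
  Dom :: "'m \<Rightarrow> 'o"
  Cod :: "'m \<Rightarrow> 'o"
  Ident :: "'o \<Rightarrow> 'm"
  Comp :: "'m \<Rightarrow> 'm \<Rightarrow> 'm"  \<comment> \<open>\<open>Comp C g f\<close> is \<open>g\<close> after \<open>f\<close>\<close>

definition Hom_set :: "('o, 'm) cat \<Rightarrow> 'o \<Rightarrow> 'o \<Rightarrow> 'm set" where
  "Hom_set C X Y = {f \<in> Mor C. Dom C f = X \<and> Cod C f = Y}"

locale category =
  fixes C :: "('o, 'm) cat"
  assumes Dom_in_Ob: "f \<in> Mor C \<Longrightarrow> Dom C f \<in> Ob C"
    and Cod_in_Ob: "f \<in> Mor C \<Longrightarrow> Cod C f \<in> Ob C"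
    and Ident_in_Hom: "X \<in> Ob C \<Longrightarrow> Ident C X \<in> Hom_set C X X"
    and Comp_in_Hom: "f \<in> Hom_set C X Y \<Longrightarrow> g \<in> Hom_set C Y Z \<Longrightarrow> Comp C g f \<in> Hom_set C X Z"
    and Comp_Ident_right: "f \<in> Hom_set C X Y \<Longrightarrow> Comp C f (Ident C X) = f"
    and Comp_Ident_left: "f \<in> Hom_set C X Y \<Longrightarrow> Comp C (Ident C Y) f = f"
    and Comp_assoc: "f \<in> Hom_set C W X \<Longrightarrow> g \<in> Hom_set C X Y \<Longrightarrow> h \<in> Hom_set C Y Z \<Longrightarrow>
        Comp C h (Comp C g f) = Comp C (Comp C h g) f"

text \<open>
  Abelian groups are commutative groups in the sense of \<^locale>\<open>comm_group\<close>, hence written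
  multiplicatively: the zero element is \<open>\<one>\<close>, the sum \<open>x + y\<close> is \<open>x \<otimes> y\<close>,
  the negative \<open>- x\<close> is \<open>inv x\<close>, and the multiple \<open>d \<cdot> x\<close>
  for an integer \<open>d\<close> is \<open>x [^] d\<close>.
  The groups \<open>F(X)\<close> share an arbitrary ambient type, but their carriers and operations are
  unrelated for different \<open>X\<close>; the maps \<open>F(f)\<close> only matter on carriers.
\<close>

record ('o, 'm, 'a) ab_functor =
  on_Ob :: "'o \<Rightarrow> 'a monoid"
  on_Mor :: "'m \<Rightarrow> 'a \<Rightarrow> 'a"

locale functor_to_Ab = category C for C :: "('o, 'm) cat" +
  fixes F :: "('o, 'm, 'a) ab_functor"
  assumes on_Ob_comm_group: "X \<in> Ob C \<Longrightarrow> comm_group (on_Ob F X)"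
    and on_Mor_hom: "f \<in> Hom_set C X Y \<Longrightarrow> on_Mor F f \<in> hom (on_Ob F X) (on_Ob F Y)"
    and on_Mor_Ident: "X \<in> Ob C \<Longrightarrow> x \<in> carrier (on_Ob F X) \<Longrightarrow> on_Mor F (Ident C X) x = x"
    and on_Mor_Comp: "f \<in> Hom_set C X Y \<Longrightarrow> g \<in> Hom_set C Y Z \<Longrightarrow> x \<in> carrier (on_Ob F X) \<Longrightarrow>
        on_Mor F (Comp C g f) x = on_Mor F g (on_Mor F f x)"

definition finite_seminorm :: "'a monoid \<Rightarrow> ('a \<Rightarrow> real) \<Rightarrow> bool" where
  "finite_seminorm A \<nu> \<longleftrightarrow>
    (\<forall>x \<in> carrier A. 0 \<le> \<nu> x) \<and>
    \<nu> \<one>\<^bsub>A\<^esub> = 0 \<and>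
    (\<forall>x \<in> carrier A. \<nu> (inv\<^bsub>A\<^esub> x) = \<nu> x) \<and>
    (\<forall>x \<in> carrier A. \<forall>y \<in> carrier A. \<nu> (x \<otimes>\<^bsub>A\<^esub> y) \<le> \<nu> x + \<nu> y)"

definition homogeneous :: "'a monoid \<Rightarrow> ('a \<Rightarrow> real) \<Rightarrow> bool" where
  "homogeneous A \<nu> \<longleftrightarrow>
    (\<forall>n::int. n \<noteq> 0 \<longrightarrow> (\<forall>x \<in> carrier A. \<nu> (x [^]\<^bsub>A\<^esub> n) = real_of_int \<bar>n\<bar> * \<nu> x))"

definition finite_functorial_seminorm ::
    "('o, 'm) cat \<Rightarrow> ('o, 'm, 'a) ab_functor \<Rightarrow> ('o \<Rightarrow> 'a \<Rightarrow> real) \<Rightarrow> bool" where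
  "finite_functorial_seminorm C F \<nu> \<longleftrightarrow>
    (\<forall>X \<in> Ob C. finite_seminorm (on_Ob F X) (\<nu> X)) \<and>
    (\<forall>X \<in> Ob C. \<forall>Y \<in> Ob C. \<forall>f \<in> Hom_set C X Y. \<forall>\<alpha> \<in> carrier (on_Ob F X).
       \<nu> Y (on_Mor F f \<alpha>) \<le> \<nu> X \<alpha>)"

definition homogeneous_functorial ::
    "('o, 'm) cat \<Rightarrow> ('o, 'm, 'a) ab_functor \<Rightarrow> ('o \<Rightarrow> 'a \<Rightarrow> real) \<Rightarrow> bool" where
  "homogeneous_functorial C F \<nu> \<longleftrightarrow> (\<forall>X \<in> Ob C. homogeneous (on_Ob F X) (\<nu> X))"

definition degree_set ::
    "('o, 'm) cat \<Rightarrow> ('o, 'm, 'a) ab_functor \<Rightarrow> 'o \<Rightarrow> 'a \<Rightarrow> 'o \<Rightarrow> 'a \<Rightarrow> int set" where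
  "degree_set C F Y \<beta> X \<alpha> = {d. \<exists>f \<in> Hom_set C Y X. on_Mor F f \<beta> = \<alpha> [^]\<^bsub>on_Ob F X\<^esub> d}"

definition weakly_flexible ::
    "('o, 'm) cat \<Rightarrow> ('o, 'm, 'a) ab_functor \<Rightarrow> 'o \<Rightarrow> 'a \<Rightarrow> bool" where
  "weakly_flexible C F X \<alpha> \<longleftrightarrow>
    (\<exists>Y \<in> Ob C. \<exists>\<beta> \<in> carrier (on_Ob F Y). infinite (degree_set C F Y \<beta> X \<alpha>))"

end

theory Submission
  imports Defs
begin

text \<open>A morphism can only shrink the semi-norm, whereas multiplying \<alpha> by d scales it by
  exactly |d|. So if \<beta> is sent to d times \<alpha>, then |d| times the semi-norm of \<alpha>
  is at most that of \<beta>, a finite number independent of d (\<open>degree_set_bound\<close>).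
  Were the semi-norm of \<alpha> positive, all such d would lie in a bounded range; but weak
  flexibility provides a \<beta> with infinitely many of them.\<close>

lemma degree_set_bound:
  assumes "X \<in> Ob C" and "\<alpha> \<in> carrier (on_Ob F X)"
    and "Y \<in> Ob C" and "\<beta> \<in> carrier (on_Ob F Y)"
    and "finite_functorial_seminorm C F \<nu>" and "homogeneous_functorial C F \<nu>"
    and "d \<in> degree_set C F Y \<beta> X \<alpha>"
  shows "real_of_int \<bar>d\<bar> * \<nu> X \<alpha> \<le> \<nu> Y \<beta>"
proof (cases "d = 0")
  \<comment> \<open>\<open>homogeneous\<close> says nothing about the multiple 0; here the bound
    reduces to nonnegativity of the semi-norm of \<beta>.\<close>
  case True
  then show ?thesis
    using assms by (simp add: finite_functorial_seminorm_def finite_seminorm_def)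
next
  case False
  obtain f where f: "f \<in> Hom_set C Y X" "on_Mor F f \<beta> = \<alpha> [^]\<^bsub>on_Ob F X\<^esub> d"
    using assms(7) by (auto simp: degree_set_def)
  have "real_of_int \<bar>d\<bar> * \<nu> X \<alpha> = \<nu> X (on_Mor F f \<beta>)"
    unfolding f(2) using False assms by (simp add: homogeneous_functorial_def homogeneous_def)
  also have "\<dots> \<le> \<nu> Y \<beta>"
    using f(1) assms by (simp add: finite_functorial_seminorm_def)
  finally show ?thesis .
qed

theorem proposition3p4:
  fixes C :: "('o, 'm) cat"
    and F :: "('o, 'm, 'a) ab_functor"
    and X :: 'o
    and \<alpha> :: 'a
    and \<nu> :: "'o \<Rightarrow> 'a \<Rightarrow> real"
  assumes "category C"
    and "functor_to_Ab C F"
    and "X \<in> Ob C"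
    and "\<alpha> \<in> carrier (on_Ob F X)"
    and "weakly_flexible C F X \<alpha>"
    and "finite_functorial_seminorm C F \<nu>"
    and "homogeneous_functorial C F \<nu>"
  shows "\<nu> X \<alpha> = 0"
proof (rule ccontr)
  assume "\<nu> X \<alpha> \<noteq> 0"
  moreover have "0 \<le> \<nu> X \<alpha>"
    using assms by (simp add: finite_functorial_seminorm_def finite_seminorm_def)
  ultimately have pos: "0 < \<nu> X \<alpha>" by simp
  obtain Y \<beta> where Y: "Y \<in> Ob C" "\<beta> \<in> carrier (on_Ob F Y)"
    and inf: "infinite (degree_set C F Y \<beta> X \<alpha>)"
    using assms(5) by (auto simp: weakly_flexible_def)
  \<comment> \<open>The largest absolute value that \<open>degree_set_bound\<close> leaves possible
    for a degree; \<open>pos\<close> is what permits dividing by the semi-norm of \<alpha>. Degrees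
    may have either sign, hence the symmetric interval below.\<close>
  define N where "N = \<lfloor>\<nu> Y \<beta> / \<nu> X \<alpha>\<rfloor>"
  have "degree_set C F Y \<beta> X \<alpha> \<subseteq> {- N..N}"
  proof
    fix d assume "d \<in> degree_set C F Y \<beta> X \<alpha>"
    then have "real_of_int \<bar>d\<bar> \<le> \<nu> Y \<beta> / \<nu> X \<alpha>"
      using degree_set_bound[OF assms(3,4) Y assms(6,7)] pos by (simp add: pos_le_divide_eq)
    then have "\<bar>d\<bar> \<le> N"
      unfolding N_def by (simp only: le_floor_iff)
    then show "d \<in> {- N..N}" by (simp add: abs_le_iff)
  qed
  \<comment> \<open>A bounded interval of integers is finite, so it cannot contain the infinite
    degree set.\<close>
  then show False using inf finite_subset by blast
qed

end
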